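(* Let $G$ be a Lie group acting differentiably on a manifold $M$ (action written $g\cdot m$), and let $\alpha: M\to G$ be a differentiable map such that $\alpha(g\cdot m)=g\,\alpha(m)\,g^{-1}$ for all $g\in G$, $m\in M$. Suppose in addition that there is an involution $\delta: M\to M$ such that $\alpha(\delta(m))=\alpha(m)^{-1}$ for all $m\in M$, and such that $\delta$ commutes with the $G$-action, i.e. $\delta(g\cdot m)=g\cdot\delta(m)$ for all $g\in G$, $m\in M$. Let $J_\alpha: M\to M$ be defined by $J_\alpha(m)=\alpha(m)\cdot m$. Then $\delta\circ J_\alpha$ is also an involution of $M$.
   Context: All groups, actions and maps are in the differentiable category. An involution of $M$ is a (differentiable) map $f: M\to M$ with $f\circ f=\mathrm{id}_M$. *)

theory Defs
  imports "HOL-Analysis.Analysis" "HOL-Algebra.Group_Action"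
begin

text \<open>
  \<open>Ck_on k f S\<close> is meant for open \<open>S\<close> in a finite-dimensional space. There, continuity of all
  directional derivatives \<open>\<lambda>x. f' x v\<close> is the same as continuity of \<open>f'\<close> in the operator norm, so
  the recursion can stay at the type of \<open>f\<close>.
\<close>

primrec Ck_on ::
    "nat \<Rightarrow> ('a::real_normed_vector \<Rightarrow> 'b::real_normed_vector) \<Rightarrow> 'a set \<Rightarrow> bool" where
  "Ck_on 0 f S \<longleftrightarrow> continuous_on S f"
| "Ck_on (Suc k) f S \<longleftrightarrow>
     (\<exists>f'. (\<forall>x\<in>S. (f has_derivative f' x) (at x)) \<and> (\<forall>v. Ck_on k (\<lambda>x. f' x v) S))"

definition smooth_on :: "('a::real_normed_vector \<Rightarrow> 'b::real_normed_vector) \<Rightarrow> 'a set \<Rightarrow> bool" where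
  "smooth_on f S \<longleftrightarrow> (\<forall>k. Ck_on k f S)"

text \<open>
  A chart is a pair of its domain and its coordinate map; values of the latter outside the domain
  are irrelevant. The atlas need not be maximal: it determines the smooth structure, and smoothness
  of maps between manifolds does not depend on the choice of a compatible atlas.
\<close>

record ('a, 'e) charted_space =
  space_top :: "'a topology"
  charts :: "('a set \<times> ('a \<Rightarrow> 'e)) set"

abbreviation points :: "('a, 'e) charted_space \<Rightarrow> 'a set" where
  "points M \<equiv> topspace (space_top M)"

definition is_chart :: "'a topology \<Rightarrow> 'a set \<Rightarrow> ('a \<Rightarrow> 'e::topological_space) \<Rightarrow> bool" where
  "is_chart X U \<phi> \<longleftrightarrow>
     openin X U \<and> open (\<phi> ` U) \<and>
     homeomorphic_map (subtopology X U) (top_of_set (\<phi> ` U)) \<phi>"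

text \<open>
  The model space is a Euclidean space, given as a finite-dimensional real inner product space.
  The class \<open>euclidean_space\<close> is not used because it excludes dimension 0, and with it discrete
  groups.
\<close>

definition smooth_manifold :: "('a, 'e::real_inner) charted_space \<Rightarrow> bool" where
  "smooth_manifold M \<longleftrightarrow>
     (\<exists>B::'e set. finite B \<and> span B = UNIV) \<and>
     Hausdorff_space (space_top M) \<and>
     second_countable (space_top M) \<and>
     (\<forall>(U, \<phi>)\<in>charts M. is_chart (space_top M) U \<phi>) \<and>
     (\<Union>(U, \<phi>)\<in>charts M. U) = points M \<and>
     (\<forall>(U, \<phi>)\<in>charts M. \<forall>(V, \<psi>)\<in>charts M.
        smooth_on (\<psi> \<circ> inv_into U \<phi>) (\<phi> ` (U \<inter> V)))"

definition smooth_map ::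
    "('a, 'e::real_inner) charted_space \<Rightarrow> ('b, 'f::real_inner) charted_space \<Rightarrow> ('a \<Rightarrow> 'b) \<Rightarrow> bool"
  where
  "smooth_map M N f \<longleftrightarrow>
     continuous_map (space_top M) (space_top N) f \<and>
     (\<forall>(U, \<phi>)\<in>charts M. \<forall>(V, \<psi>)\<in>charts N.
        smooth_on (\<psi> \<circ> f \<circ> inv_into U \<phi>) (\<phi> ` (U \<inter> f -` V)))"

definition prod_manifold ::
    "('a, 'e) charted_space \<Rightarrow> ('b, 'f) charted_space \<Rightarrow> ('a \<times> 'b, 'e \<times> 'f) charted_space" where
  "prod_manifold M N =
     \<lparr>space_top = prod_topology (space_top M) (space_top N),
      charts = {(U \<times> V, map_prod \<phi> \<psi>) | U \<phi> V \<psi>. (U, \<phi>) \<in> charts M \<and> (V, \<psi>) \<in> charts N}\<rparr>"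

definition lie_group :: "('g, 'x) monoid_scheme \<Rightarrow> ('g, 'e::real_inner) charted_space \<Rightarrow> bool" where
  "lie_group G GM \<longleftrightarrow>
     group G \<and> smooth_manifold GM \<and> points GM = carrier G \<and>
     smooth_map (prod_manifold GM GM) GM (\<lambda>(g, h). g \<otimes>\<^bsub>G\<^esub> h) \<and>
     smooth_map GM GM (\<lambda>g. inv\<^bsub>G\<^esub> g)"

text \<open>
  The library's \<open>group_action\<close> asks each \<open>act g\<close> to be an extensional function, that is, to take
  the value \<open>undefined\<close> off the manifold. This only normalises junk values.
\<close>

definition smooth_action ::
    "('g, 'x) monoid_scheme \<Rightarrow> ('g, 'e::real_inner) charted_space \<Rightarrow>
     ('m, 'f::real_inner) charted_space \<Rightarrow> ('g \<Rightarrow> 'm \<Rightarrow> 'm) \<Rightarrow> bool" where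
  "smooth_action G GM M act \<longleftrightarrow>
     group_action G (points M) act \<and>
     smooth_map (prod_manifold GM M) M (\<lambda>(g, m). act g m)"

definition smooth_involution :: "('m, 'f::real_inner) charted_space \<Rightarrow> ('m \<Rightarrow> 'm) \<Rightarrow> bool" where
  "smooth_involution M f \<longleftrightarrow> smooth_map M M f \<and> (\<forall>m\<in>points M. f (f m) = m)"

definition J_map :: "('g \<Rightarrow> 'm \<Rightarrow> 'm) \<Rightarrow> ('m \<Rightarrow> 'g) \<Rightarrow> 'm \<Rightarrow> 'm" where
  "J_map act \<alpha> m = act (\<alpha> m) m"

end

theory Submission
  imports Defs
begin

text \<open>
  Since \<open>\<delta>\<close> commutes with the action, \<open>\<delta> (J m) = \<alpha> m \<cdot> \<delta> m\<close>. Equivariance of \<open>\<alpha>\<close> and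
  \<open>\<alpha> (\<delta> m) = (\<alpha> m)\<inverse>\<close> give \<open>\<alpha> (\<alpha> m \<cdot> \<delta> m) = (\<alpha> m)\<inverse>\<close>, so a second application of \<open>J\<close> cancels
  the factor \<open>\<alpha> m\<close> and leaves \<open>\<delta> m\<close>. Smoothness holds because \<open>J\<close> is the action composed with
  \<open>m \<mapsto> (\<alpha> m, m)\<close>; this needs the chain rule for \<open>Ck_on\<close>.
\<close>

section \<open>Closure properties of \<open>Ck_on\<close> in normed spaces\<close>

lemma Ck_on_subset: "Ck_on k f S \<Longrightarrow> T \<subseteq> S \<Longrightarrow> Ck_on k f T"
proof (induction k arbitrary: f)
  case 0
  then show ?case by (auto intro: continuous_on_subset)
next
  case (Suc k)
  then show ?case by simp (meson subsetD)
qed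

text \<open>At the bottom, differentiability gives continuity; higher up, the induction acts on the
  directional derivatives. The product and chain rules need this because they keep some factors
  undifferentiated.\<close>

lemma Ck_on_Suc_lower: "Ck_on (Suc k) f S \<Longrightarrow> Ck_on k f S"
proof (induction k arbitrary: f)
  case 0
  then obtain f' where "\<forall>x\<in>S. (f has_derivative f' x) (at x)"
    by auto
  then show ?case
    by (auto intro!: continuous_at_imp_continuous_on dest: has_derivative_continuous)
next
  case (Suc k)
  then obtain f' where "\<forall>x\<in>S. (f has_derivative f' x) (at x)" "\<forall>v. Ck_on (Suc k) (\<lambda>x. f' x v) S"
    by (auto simp del: Ck_on.simps simp: Ck_on.simps(2)[of "Suc k"])
  with Suc.IH show ?case by (auto simp del: Ck_on.simps simp: Ck_on.simps(2)[of k])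
qed

text \<open>A derivative at a point depends on a whole neighbourhood, which openness of
  \<open>S\<close> keeps inside the region of agreement. Hence the derivative of \<open>f\<close> is
  also a derivative of \<open>g\<close>.\<close>

lemma Ck_on_cong:
  assumes "open S" "\<And>x. x \<in> S \<Longrightarrow> f x = g x" "Ck_on k f S"
  shows "Ck_on k g S"
proof (cases k)
  case 0
  then show ?thesis using assms by (auto cong: continuous_on_cong)
next
  case (Suc j)
  with assms(3) obtain f' where f': "\<And>x. x \<in> S \<Longrightarrow> (f has_derivative f' x) (at x)"
    "\<forall>v. Ck_on j (\<lambda>x. f' x v) S"
    by auto
  have "(g has_derivative f' x) (at x)" if "x \<in> S" for x
    using has_derivative_transform_within_open[OF f'(1)[OF that] assms(1) that assms(2)] .
  with f'(2) Suc show ?thesis by auto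
qed

lemma Ck_on_locally:
  assumes "\<And>x. x \<in> S \<Longrightarrow> \<exists>T. open T \<and> x \<in> T \<and> Ck_on k f T"
  shows "Ck_on k f S"
  using assms
proof (induction k arbitrary: f)
  case 0
  then show ?case
    by (metis Ck_on.simps(1) continuous_at_imp_continuous_on continuous_on_eq_continuous_at)
next
  case (Suc k)
  \<comment> \<open>The local derivatives come from separate choices, one for each neighbourhood.
    \<open>frechet_derivative\<close> is a single global choice, and uniqueness of derivatives
    identifies it with each local one.\<close>
  define f' where "f' x = frechet_derivative f (at x)" for x
  have local: "\<exists>T. open T \<and> x \<in> T \<and> (\<forall>y\<in>T. (f has_derivative f' y) (at y)) \<and>
      (\<forall>v. Ck_on k (\<lambda>y. f' y v) T)" if x: "x \<in> S" for x
  proof -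
    obtain T g where T: "open T" "x \<in> T" and g: "\<And>y. y \<in> T \<Longrightarrow> (f has_derivative g y) (at y)"
      "\<And>v. Ck_on k (\<lambda>y. g y v) T"
      using Suc.prems[OF x] by auto
    have "f' y = g y" if "y \<in> T" for y
      unfolding f'_def using frechet_derivative_at[OF g(1)[OF that]] by simp
    then show ?thesis
      using T g Ck_on_cong[OF T(1) _ g(2)] by (intro exI[of _ T]) auto
  qed
  then have "Ck_on k (\<lambda>y. f' y v) S" for v
    by (intro Suc.IH) blast
  with local show ?case by fastforce
qed

lemma Ck_on_const: "Ck_on k (\<lambda>x. c) S"
proof (induction k arbitrary: c)
  case (Suc k)
  then show ?case by (auto intro!: exI[of _ "\<lambda>x v. 0"])
qed simp

lemma Ck_on_Pair:
  "Ck_on k f S \<Longrightarrow> Ck_on k g S \<Longrightarrow> Ck_on k (\<lambda>x. (f x, g x)) S"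
proof (induction k arbitrary: f g)
  case 0
  then show ?case by (auto intro: continuous_on_Pair)
next
  case (Suc k)
  then obtain f' g' where "\<forall>x\<in>S. (f has_derivative f' x) (at x)" "\<forall>v. Ck_on k (\<lambda>x. f' x v) S"
    "\<forall>x\<in>S. (g has_derivative g' x) (at x)" "\<forall>v. Ck_on k (\<lambda>x. g' x v) S"
    by auto
  with Suc.IH show ?case
    by (auto intro!: exI[of _ "\<lambda>x v. (f' x v, g' x v)"] has_derivative_Pair)
qed

lemma Ck_on_add:
  "Ck_on k f S \<Longrightarrow> Ck_on k g S \<Longrightarrow> Ck_on k (\<lambda>x. f x + g x) S"
proof (induction k arbitrary: f g)
  case 0
  then show ?case by (auto intro: continuous_on_add)
next
  case (Suc k)
  then obtain f' g' where "\<forall>x\<in>S. (f has_derivative f' x) (at x)" "\<forall>v. Ck_on k (\<lambda>x. f' x v) S"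
    "\<forall>x\<in>S. (g has_derivative g' x) (at x)" "\<forall>v. Ck_on k (\<lambda>x. g' x v) S"
    by auto
  with Suc.IH show ?case
    by (auto intro!: exI[of _ "\<lambda>x v. f' x v + g' x v"] has_derivative_add)
qed

lemma Ck_on_sum:
  "(\<And>i. i \<in> I \<Longrightarrow> Ck_on k (f i) S) \<Longrightarrow> Ck_on k (\<lambda>x. \<Sum>i\<in>I. f i x) S"
  by (induction I rule: infinite_finite_induct) (auto intro: Ck_on_const Ck_on_add)

lemma Ck_on_bounded_linear:
  assumes "bounded_linear h"
  shows "Ck_on k f S \<Longrightarrow> Ck_on k (\<lambda>x. h (f x)) S"
proof (induction k arbitrary: f)
  case 0
  then show ?case by (auto intro: bounded_linear.continuous_on[OF assms])
next
  case (Suc k)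
  then obtain f' where "\<forall>x\<in>S. (f has_derivative f' x) (at x)" "\<forall>v. Ck_on k (\<lambda>x. f' x v) S"
    by auto
  with Suc.IH show ?case
    by (auto intro!: exI[of _ "\<lambda>x v. h (f' x v)"] bounded_linear.has_derivative[OF assms])
qed

lemma Ck_on_scaleR:
  "Ck_on k f S \<Longrightarrow> Ck_on k g S \<Longrightarrow> Ck_on k (\<lambda>x. f x *\<^sub>R g x) S"
proof (induction k arbitrary: f g)
  case 0
  then show ?case by (auto intro: continuous_on_scaleR)
next
  case (Suc k)
  then obtain f' g' where "\<forall>x\<in>S. (f has_derivative f' x) (at x)" "\<forall>v. Ck_on k (\<lambda>x. f' x v) S"
    "\<forall>x\<in>S. (g has_derivative g' x) (at x)" "\<forall>v. Ck_on k (\<lambda>x. g' x v) S"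
    by auto
  \<comment> \<open>The product rule multiplies each derivative, of order \<open>k\<close>, by the
    other factor itself, which therefore has to be lowered to order \<open>k\<close>.\<close>
  with Suc.IH Suc.prems[THEN Ck_on_Suc_lower] show ?case
    by (auto intro!: exI[of _ "\<lambda>x v. f x *\<^sub>R g' x v + f' x v *\<^sub>R g x"] has_derivative_scaleR Ck_on_add)
qed

section \<open>The chain rule over finite-dimensional inner product spaces\<close>

lemma orthogonal_expansion:
  fixes C :: "'a::real_inner set"
  assumes "finite C" "pairwise orthogonal C" "w \<in> span C"
  shows "w = (\<Sum>c\<in>C. (w \<bullet> c / (c \<bullet> c)) *\<^sub>R c)"
proof -
  obtain u where u: "w = (\<Sum>c\<in>C. u c *\<^sub>R c)"
    using assms(1,3) by (auto simp: span_finite)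
  \<comment> \<open>Pairing with \<open>c\<close> annihilates all other terms of the expansion and
    so isolates its coefficient.\<close>
  have "w \<bullet> c = u c * (c \<bullet> c)" if "c \<in> C" for c
  proof -
    have "w \<bullet> c = (\<Sum>b\<in>C. u b * (b \<bullet> c))"
      by (simp add: u inner_sum_left)
    also have "\<dots> = (\<Sum>b\<in>C. if b = c then u c * (c \<bullet> c) else 0)"
      using assms(2) that by (intro sum.cong) (auto simp: pairwise_def orthogonal_def)
    finally show ?thesis using assms(1) that by simp
  qed
  \<comment> \<open>The set \<open>C\<close> may contain the zero vector. Its coefficient is then
    undetermined, but its term vanishes on both sides.\<close>
  then have "(w \<bullet> c / (c \<bullet> c)) *\<^sub>R c = u c *\<^sub>R c" if "c \<in> C" for c
    using that by (cases "c = 0") auto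
  then have "(\<Sum>c\<in>C. (w \<bullet> c / (c \<bullet> c)) *\<^sub>R c) = (\<Sum>c\<in>C. u c *\<^sub>R c)"
    by (intro sum.cong) auto
  with u show ?thesis by simp
qed

text \<open>
  \<open>Ck_on\<close> only controls \<open>g' y v\<close> for fixed \<open>v\<close>, whereas the chain rule produces
  \<open>g' (f x) (f' x v)\<close>, whose second argument varies with \<open>x\<close>. Expanding that argument in a finite
  orthogonal basis leaves only values of \<open>g'\<close> at constant vectors.
\<close>

lemma Ck_on_compose:
  fixes f :: "'a::real_normed_vector \<Rightarrow> 'b::real_inner" and g :: "'b \<Rightarrow> 'c::real_normed_vector"
  assumes "finite B" "span B = (UNIV :: 'b set)"
  shows "Ck_on k f S \<Longrightarrow> Ck_on k g T \<Longrightarrow> f ` S \<subseteq> T \<Longrightarrow> Ck_on k (\<lambda>x. g (f x)) S"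
\<comment> \<open>The outer function must vary: the induction hypothesis is applied to
  \<open>\<lambda>y. g' y c\<close> for each basis vector \<open>c\<close>, always with the same
  inner function \<open>f\<close>.\<close>
proof (induction k arbitrary: g)
  case 0
  then show ?case by (auto intro: continuous_on_compose2)
next
  case (Suc k)
  obtain C :: "'b set" where C: "finite C" "span C = UNIV" "pairwise orthogonal C"
    using basis_orthogonal[OF assms(1)] assms(2) by auto
  obtain f' where f': "\<And>x. x \<in> S \<Longrightarrow> (f has_derivative f' x) (at x)" "\<And>v. Ck_on k (\<lambda>x. f' x v) S"
    using Suc.prems(1) by auto
  obtain g' where g': "\<And>y. y \<in> T \<Longrightarrow> (g has_derivative g' y) (at y)" "\<And>v. Ck_on k (\<lambda>y. g' y v) T"
    using Suc.prems(2) by auto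
  define h where
    "h x v = (\<Sum>c\<in>C. (f' x v \<bullet> c / (c \<bullet> c)) *\<^sub>R g' (f x) c)" for x v
  have "((\<lambda>x. g (f x)) has_derivative h x) (at x)" if "x \<in> S" for x
  proof -
    have g'x: "(g has_derivative g' (f x)) (at (f x))"
      using that Suc.prems(3) by (intro g') auto
    interpret linear "g' (f x)"
      using g'x by (rule has_derivative_linear)
    have "g' (f x) (f' x v) = h x v" for v
      by (subst orthogonal_expansion[OF C(1,3)]) (auto simp: C(2) sum scale h_def)
    then show ?thesis
      using has_derivative_compose[OF f'(1)[OF that] g'x] by simp
  qed
  moreover have "bounded_linear (\<lambda>w. w \<bullet> c / (c \<bullet> c))" for c :: 'b
    by (rule bounded_linear_compose[OF bounded_linear_divide bounded_linear_inner_left])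
  then have "Ck_on k (\<lambda>x. h x v) S" for v
    unfolding h_def
    by (intro Ck_on_sum Ck_on_scaleR Suc.IH g' Suc.prems(3) Ck_on_Suc_lower[OF Suc.prems(1)]
        Ck_on_bounded_linear[where h="\<lambda>w. w \<bullet> c / (c \<bullet> c)" for c] f')
  ultimately show ?case by auto
qed


text \<open>Every \<open>(x, y)\<close> splits as \<open>(x, 0) + (0, y)\<close>. This makes the
  chain rule available when the intermediate space models a product manifold.\<close>

lemma finite_span_prod:
  assumes "finite A" "span A = (UNIV :: 'a::real_vector set)"
    and "finite B" "span B = (UNIV :: 'b::real_vector set)"
  shows "finite (A \<times> {0} \<union> {0} \<times> B)" "span (A \<times> {0} \<union> {0} \<times> B) = UNIV"
proof -
  have lin: "linear (\<lambda>x. (x :: 'a, 0 :: 'b))" "linear (\<lambda>y. (0 :: 'a, y :: 'b))"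
    by (auto intro!: linearI)
  have l: "(\<lambda>x. (x, 0 :: 'b)) ` A = A \<times> {0}" and r: "(\<lambda>y. (0 :: 'a, y)) ` B = {0} \<times> B"
    by auto
  have "(x, y) \<in> span (A \<times> {0} \<union> {0} \<times> B)" for x :: 'a and y :: 'b
  proof -
    have "(x, 0 :: 'b) \<in> span (A \<times> {0})"
      using span_linear_image[OF lin(1), of A] assms(2) by (auto simp: l)
    moreover have "(0 :: 'a, y) \<in> span ({0} \<times> B)"
      using span_linear_image[OF lin(2), of B] assms(4) by (auto simp: r)
    ultimately have "(x, 0) + (0, y) \<in> span (A \<times> {0} \<union> {0} \<times> B)"
      by (intro span_add) (auto intro: span_mono[THEN subsetD])
    then show ?thesis by simp
  qed
  then show "span (A \<times> {0} \<union> {0} \<times> B) = UNIV" by auto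
  show "finite (A \<times> {0} \<union> {0} \<times> B)" using assms by simp
qed

section \<open>Topology of charts\<close>

lemma is_chart_inj_on: "is_chart X U \<phi> \<Longrightarrow> inj_on \<phi> U"
  unfolding is_chart_def
  by (metis homeomorphic_imp_injective_map openin_subset topspace_subtopology_subset)

lemma is_chart_open_image:
  assumes "is_chart X U \<phi>" "openin X A" "A \<subseteq> U"
  shows "open (\<phi> ` A)"
proof -
  have "openin (subtopology X U) A"
    using assms by (auto simp: openin_subtopology_alt)
  then have "openin (top_of_set (\<phi> ` U)) (\<phi> ` A)"
    using assms(1) homeomorphic_imp_open_map unfolding is_chart_def open_map_def by blast
  then show ?thesis
    using assms(1) by (auto simp: is_chart_def openin_open_eq)
qed

section \<open>Composition and pairing of smooth maps\<close>

lemma smooth_mapD: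
  assumes "smooth_map M N f" "(U, \<phi>) \<in> charts M" "(V, \<psi>) \<in> charts N"
  shows "Ck_on k (\<psi> \<circ> f \<circ> inv_into U \<phi>) (\<phi> ` (U \<inter> f -` V))"
  using assms unfolding smooth_map_def smooth_on_def by fast

text \<open>Near each point a chart of \<open>N\<close> is inserted between \<open>f\<close> and
  \<open>g\<close>, and the chain rule applies to the two coordinate expressions. The conditions on
  \<open>N\<close> are listed singly so that they can be checked directly for a product of
  manifolds.\<close>

lemma smooth_map_compose:
  fixes M :: "('a, 'e::real_inner) charted_space"
    and N :: "('b, 'f::real_inner) charted_space"
    and P :: "('c, 'g::real_inner) charted_space"
  assumes M: "\<And>U \<phi>. (U, \<phi>) \<in> charts M \<Longrightarrow> is_chart (space_top M) U \<phi>"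
    and N: "\<And>V \<psi>. (V, \<psi>) \<in> charts N \<Longrightarrow> openin (space_top N) V \<and> inj_on \<psi> V"
      "points N \<subseteq> (\<Union>(V, \<psi>)\<in>charts N. V)"
      "finite B" "span B = (UNIV :: 'f set)"
    and P: "\<And>W \<theta>. (W, \<theta>) \<in> charts P \<Longrightarrow> openin (space_top P) W"
    and f: "smooth_map M N f" and g: "smooth_map N P g"
  shows "smooth_map M P (g \<circ> f)"
  unfolding smooth_map_def
proof safe
  have cf: "continuous_map (space_top M) (space_top N) f"
    and cg: "continuous_map (space_top N) (space_top P) g"
    using f g by (auto simp: smooth_map_def)
  then show cgf: "continuous_map (space_top M) (space_top P) (g \<circ> f)"
    by (rule continuous_map_compose)
  fix U \<phi> W \<theta>
  assume U: "(U, \<phi>) \<in> charts M" and W: "(W, \<theta>) \<in> charts P"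
  have inj: "inj_on \<phi> U" and opU: "openin (space_top M) U"
    using is_chart_inj_on[OF M[OF U]] M[OF U] by (auto simp: is_chart_def)
  show "smooth_on (\<theta> \<circ> (g \<circ> f) \<circ> inv_into U \<phi>) (\<phi> ` (U \<inter> (g \<circ> f) -` W))"
    unfolding smooth_on_def
  \<comment> \<open>The chart of \<open>N\<close> to be inserted depends on the point, so the claim
    is reduced to neighbourhoods.\<close>
  proof (intro allI Ck_on_locally)
    fix k x
    assume "x \<in> \<phi> ` (U \<inter> (g \<circ> f) -` W)"
    then obtain m where m: "m \<in> U" "g (f m) \<in> W" "x = \<phi> m" by auto
    have "f m \<in> points N"
      using cf m(1) openin_subset[OF opU] by (auto simp: continuous_map_def)
    then obtain V \<psi> where V: "(V, \<psi>) \<in> charts N" "f m \<in> V"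
      using N(2) by auto
    define A where "A = U \<inter> f -` (V \<inter> g -` W)"
    \<comment> \<open>The preimages in \<open>A\<close> range over the whole type; cut down to
      \<open>points M\<close> they are preimages under continuous maps, hence open.\<close>
    have "A = U \<inter> ({a \<in> points M. f a \<in> V} \<inter> {a \<in> points M. (g \<circ> f) a \<in> W})"
      using openin_subset[OF opU] by (auto simp: A_def)
    moreover have "openin (space_top M) {a \<in> points M. f a \<in> V}"
      using cf N(1)[OF V(1)] by (auto intro: openin_continuous_map_preimage)
    moreover have "openin (space_top M) {a \<in> points M. (g \<circ> f) a \<in> W}"
      using cgf P[OF W] by (rule openin_continuous_map_preimage)
    ultimately have "openin (space_top M) A"
      using opU by auto
    then have opA: "open (\<phi> ` A)"
      by (rule is_chart_open_image[OF M[OF U]]) (auto simp: A_def)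
    let ?f = "\<psi> \<circ> f \<circ> inv_into U \<phi>" and ?g = "\<theta> \<circ> g \<circ> inv_into V \<psi>"
    have inv: "inv_into U \<phi> y \<in> A" if "y \<in> \<phi> ` A" for y
      using that inj by (auto simp: A_def)
    have "Ck_on k ?f (\<phi> ` A)"
      by (rule Ck_on_subset[OF smooth_mapD[OF f U V(1)]]) (auto simp: A_def)
    moreover have "Ck_on k ?g (\<psi> ` (V \<inter> g -` W))"
      by (rule smooth_mapD[OF g V(1) W])
    moreover have "?f ` \<phi> ` A \<subseteq> \<psi> ` (V \<inter> g -` W)"
      using inv by (fastforce simp: A_def)
    ultimately have "Ck_on k (\<lambda>y. ?g (?f y)) (\<phi> ` A)"
      by (rule Ck_on_compose[OF N(3,4)])
    then have "Ck_on k (\<theta> \<circ> (g \<circ> f) \<circ> inv_into U \<phi>) (\<phi> ` A)"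
    \<comment> \<open>\<open>inv_into V \<psi>\<close> cancels \<open>\<psi>\<close> only on
      \<open>V\<close>, so the two expressions are compared on the image of \<open>A\<close>
      alone.\<close>
    proof (rule Ck_on_cong[OF opA, rotated])
      fix y assume "y \<in> \<phi> ` A"
      then have "f (inv_into U \<phi> y) \<in> V" using inv by (auto simp: A_def)
      then show "?g (?f y) = (\<theta> \<circ> (g \<circ> f) \<circ> inv_into U \<phi>) y"
        using N(1)[OF V(1)] by simp
    qed
    moreover have "x \<in> \<phi> ` A"
      using m V(2) by (auto simp: A_def)
    ultimately show "\<exists>T. open T \<and> x \<in> T \<and> Ck_on k (\<theta> \<circ> (g \<circ> f) \<circ> inv_into U \<phi>) T"
      using opA by blast
  qed
qed

text \<open>In coordinates the identity is a transition map, smooth by compatibility of the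
  charts.\<close>

lemma smooth_map_id: "smooth_manifold M \<Longrightarrow> smooth_map M M (\<lambda>m. m)"
  by (fastforce simp: smooth_map_def smooth_manifold_def comp_def)

lemma smooth_map_paired:
  assumes "smooth_map K M f" "smooth_map K N g"
  shows "smooth_map K (prod_manifold M N) (\<lambda>x. (f x, g x))"
  unfolding smooth_map_def
proof safe
  show "continuous_map (space_top K) (space_top (prod_manifold M N)) (\<lambda>x. (f x, g x))"
    using assms by (auto simp: smooth_map_def prod_manifold_def continuous_map_pairedI)
  fix U \<phi> X \<xi>
  assume U: "(U, \<phi>) \<in> charts K" and "(X, \<xi>) \<in> charts (prod_manifold M N)"
  then obtain V \<psi> W \<theta> where V: "(V, \<psi>) \<in> charts M" and W: "(W, \<theta>) \<in> charts N"
    and X: "X = V \<times> W" "\<xi> = map_prod \<psi> \<theta>"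
    by (auto simp: prod_manifold_def)
  let ?D = "\<phi> ` (U \<inter> (\<lambda>x. (f x, g x)) -` X)"
  have "Ck_on k (\<psi> \<circ> f \<circ> inv_into U \<phi>) ?D" for k
    by (rule Ck_on_subset[OF smooth_mapD[OF assms(1) U V]]) (auto simp: X)
  moreover have "Ck_on k (\<theta> \<circ> g \<circ> inv_into U \<phi>) ?D" for k
    by (rule Ck_on_subset[OF smooth_mapD[OF assms(2) U W]]) (auto simp: X)
  ultimately have "Ck_on k (\<lambda>y. ((\<psi> \<circ> f \<circ> inv_into U \<phi>) y, (\<theta> \<circ> g \<circ> inv_into U \<phi>) y)) ?D" for k
    by (rule Ck_on_Pair)
  then show "smooth_on (\<xi> \<circ> (\<lambda>x. (f x, g x)) \<circ> inv_into U \<phi>) ?D"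
    by (simp add: smooth_on_def X comp_def)
qed

lemma smooth_manifold_is_chart:
  "smooth_manifold M \<Longrightarrow> (U, \<phi>) \<in> charts M \<Longrightarrow> is_chart (space_top M) U \<phi>"
  by (auto simp: smooth_manifold_def)

lemma smooth_manifold_chart:
  "smooth_manifold M \<Longrightarrow> (U, \<phi>) \<in> charts M \<Longrightarrow> openin (space_top M) U \<and> inj_on \<phi> U"
  using smooth_manifold_is_chart[of M U \<phi>] is_chart_inj_on by (auto simp: is_chart_def)

lemma smooth_map_compose_manifold:
  fixes N :: "('b, 'f::real_inner) charted_space"
  assumes "smooth_manifold M" "smooth_manifold N" "smooth_manifold P"
    and "smooth_map M N f" "smooth_map N P g"
  shows "smooth_map M P (g \<circ> f)"
proof -
  obtain B :: "'f set" where B: "finite B" "span B = UNIV"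
    using assms(2) unfolding smooth_manifold_def by blast
  have "points N \<subseteq> (\<Union>(V, \<psi>)\<in>charts N. V)"
    using assms(2) by (simp add: smooth_manifold_def)
  then show ?thesis
    using smooth_manifold_is_chart[OF assms(1)] smooth_manifold_chart[OF assms(2)]
      smooth_manifold_chart[OF assms(3)]
    by (intro smooth_map_compose[OF _ _ _ B _ assms(4,5)]) blast+
qed

text \<open>Serves to compose the action map with \<open>m \<mapsto> (\<alpha> m, m)\<close>.
  Products of charts inherit openness, injectivity and covering from their factors.\<close>

lemma smooth_map_compose_prod:
  fixes N :: "('b, 'f::real_inner) charted_space"
    and N' :: "('c, 'g::real_inner) charted_space"
  assumes M: "smooth_manifold M" and N: "smooth_manifold N" and N': "smooth_manifold N'"
    and P: "smooth_manifold P"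
    and f: "smooth_map M (prod_manifold N N') f" and g: "smooth_map (prod_manifold N N') P g"
  shows "smooth_map M P (g \<circ> f)"
proof -
  obtain B :: "'f set" where B: "finite B" "span B = UNIV"
    and cover: "(\<Union>(V, \<psi>)\<in>charts N. V) = points N"
    using N by (auto simp: smooth_manifold_def)
  obtain B' :: "'g set" where B': "finite B'" "span B' = UNIV"
    and cover': "(\<Union>(V, \<psi>)\<in>charts N'. V) = points N'"
    using N' by (auto simp: smooth_manifold_def)
  show ?thesis
  proof (rule smooth_map_compose[OF _ _ _ finite_span_prod[OF B B'] _ f g])
    fix X \<xi> assume "(X, \<xi>) \<in> charts (prod_manifold N N')"
    then show "openin (space_top (prod_manifold N N')) X \<and> inj_on \<xi> X"
      using smooth_manifold_chart[OF N] smooth_manifold_chart[OF N']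
      by (auto simp: prod_manifold_def openin_prod_Times_iff intro!: map_prod_inj_on)
  next
    show "points (prod_manifold N N') \<subseteq> (\<Union>(X, \<xi>)\<in>charts (prod_manifold N N'). X)"
    proof
      fix p assume "p \<in> points (prod_manifold N N')"
      then obtain a b where p: "p = (a, b)" "a \<in> points N" "b \<in> points N'"
        by (auto simp: prod_manifold_def)
      then obtain V \<psi> W \<theta> where "(V, \<psi>) \<in> charts N" "a \<in> V" "(W, \<theta>) \<in> charts N'" "b \<in> W"
        unfolding cover[symmetric] cover'[symmetric] by auto
      then have "(V \<times> W, map_prod \<psi> \<theta>) \<in> charts (prod_manifold N N')" "p \<in> V \<times> W"
        using p by (auto simp: prod_manifold_def)
      then show "p \<in> (\<Union>(X, \<xi>)\<in>charts (prod_manifold N N'). X)" by blast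
    qed
  qed (use smooth_manifold_is_chart[OF M] smooth_manifold_chart[OF P] in auto)
qed

section \<open>The involution twisted by the group action\<close>

theorem theorem2p2:
  fixes G :: "('g, 'x) monoid_scheme" (structure)
    and GM :: "('g, 'e::real_inner) charted_space"
    and M :: "('m, 'f::real_inner) charted_space"
    and act :: "'g \<Rightarrow> 'm \<Rightarrow> 'm"
    and \<alpha> :: "'m \<Rightarrow> 'g"
    and \<delta> :: "'m \<Rightarrow> 'm"
  assumes "lie_group G GM"
    and "smooth_manifold M"
    and "smooth_action G GM M act"
    and "smooth_map M GM \<alpha>"
    and "\<And>g m. g \<in> carrier G \<Longrightarrow> m \<in> points M \<Longrightarrow> \<alpha> (act g m) = g \<otimes> \<alpha> m \<otimes> inv g"
    and "smooth_involution M \<delta>"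
    and "\<And>m. m \<in> points M \<Longrightarrow> \<alpha> (\<delta> m) = inv (\<alpha> m)"
    and "\<And>g m. g \<in> carrier G \<Longrightarrow> m \<in> points M \<Longrightarrow> \<delta> (act g m) = act g (\<delta> m)"
  shows "smooth_involution M (\<delta> \<circ> J_map act \<alpha>)"
proof -
  note lie = assms(1) and M = assms(2) and equiv = assms(5) and inv_\<delta> = assms(7) and comm = assms(8)
  have GM: "smooth_manifold GM" and pts: "points GM = carrier G"
    using lie by (auto simp: lie_group_def)
  interpret group G using lie by (simp add: lie_group_def)
  interpret A: group_action G "points M" act
    using assms(3) by (simp add: smooth_action_def)
  have \<alpha>: "\<alpha> m \<in> carrier G" if "m \<in> points M" for m
    using assms(4) that pts by (auto simp: smooth_map_def continuous_map_def)
  have \<delta>: "\<delta> m \<in> points M" "\<delta> (\<delta> m) = m" if "m \<in> points M" for m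
    using assms(6) that by (auto simp: smooth_involution_def smooth_map_def continuous_map_def)
  have "(case_prod act) \<circ> (\<lambda>m. (\<alpha> m, m)) = J_map act \<alpha>"
    by (auto simp: J_map_def)
  moreover have "smooth_map M M (case_prod act \<circ> (\<lambda>m. (\<alpha> m, m)))"
    using assms(3) by (intro smooth_map_compose_prod[OF M GM M M] smooth_map_paired
        smooth_map_id M assms(4)) (simp add: smooth_action_def)
  ultimately have "smooth_map M M (\<delta> \<circ> J_map act \<alpha>)"
    using assms(6) by (auto simp: smooth_involution_def intro: smooth_map_compose_manifold[OF M M M])
  moreover have "(\<delta> \<circ> J_map act \<alpha>) ((\<delta> \<circ> J_map act \<alpha>) m) = m" if m: "m \<in> points M" for m
  proof -
    let ?a = "\<alpha> m"
    have \<delta>J: "(\<delta> \<circ> J_map act \<alpha>) m = act ?a (\<delta> m)"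
      using m \<alpha> comm by (simp add: J_map_def)
    have "\<alpha> (act ?a (\<delta> m)) = ?a \<otimes> inv ?a \<otimes> inv ?a"
      using m \<alpha> \<delta> equiv inv_\<delta> by simp
    also have "\<dots> = inv ?a"
      using \<alpha>[OF m] by simp
    finally have "J_map act \<alpha> (act ?a (\<delta> m)) = act (inv ?a) (act ?a (\<delta> m))"
      by (simp add: J_map_def)
    also have "\<dots> = act (inv ?a \<otimes> ?a) (\<delta> m)"
      using A.composition_rule[OF \<delta>(1)[OF m] inv_closed[OF \<alpha>[OF m]] \<alpha>[OF m]] by (rule sym)
    \<comment> \<open>In \<open>group_action\<close> the unit acts as the identity restricted to
      \<open>points M\<close>, so membership of \<open>\<delta> m\<close> enters here.\<close>
    also have "\<dots> = \<delta> m"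
      using \<alpha>[OF m] \<delta>(1)[OF m] A.id_eq_one by (metis l_inv restrict_apply')
    finally show ?thesis
      using \<delta>J \<delta>(2)[OF m] by simp
  qed
  ultimately show ?thesis by (simp add: smooth_involution_def)
qed

end
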